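(* Let $m_1,\ldots,m_k$ be positive integers with sum $M$, let $L=\prod_{i=1}^{k}\binom{m_1+\cdots+m_i}{m_i}$, and let $\alpha_1,\ldots,\alpha_L$ be representatives, one from each, of the distinct families $\mathrm{fam}(\alpha)$ of exact $k$-typed parking functions of order $(m_1,\ldots,m_k)$. Then $$\prod_{i=2}^{k}\left(1+\sum_{j=1}^{i-1}m_j\right)^{m_i}=\sum_{j=1}^{L}F(\alpha_j).$$
   Context: There are $M$ cars, $m_i$ of them of type $i$, and $M$ parking spots in a row. Consider tuples $\alpha=(m_1;P_2,\ldots,P_k)$, where each $P_i=(p^{(i)}_1,\ldots,p^{(i)}_{m_i})$ is an ordered list of nonnegative integers (for $k=1$, $\alpha=(m_1)$). Such an $\alpha$ is an exact $k$-typed parking function (exact $k$-TPF) of order $(m_1,\ldots,m_k)$ if there is an arrangement of the $M$ cars in the $M$ spots, one car per spot, such that for all $2\le i\le k$ and $1\le j\le m_i$ the $j$-th car of type $i$ has exactly $p^{(i)}_j$ cars of types in $\{1,\ldots,i-1\}$ parked before it. An exact $k$-TPF $\beta=(m_1;Q_2,\ldots,Q_k)$ is a parking permutation of $\alpha=(m_1;P_2,\ldots,P_k)$ if for every $i=2,\ldots,k$ the list $Q_i$ is a rearrangement of the list $P_i$. The family $\mathrm{fam}(\alpha)$ is the set of all parking permutations of $\alpha$ (including $\alpha$ itself); there are exactly $L$ distinct families of the given order. For an exact $k$-TPF $\alpha$ of order $(m_1,\ldots,m_k)$, $$F(\alpha)=\prod_{i=1}^{k}\frac{m_i!}{a_{i_0}!\,a_{i_1}!\cdots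 a_{i_{\mu_i}}!},\qquad \mu_i=\sum_{j=1}^{i-1}m_j,$$ where for $i\ge2$ and $0\le j\le\mu_i$, $a_{i_j}$ is the number of entries of $P_i$ equal to $j$, and the factor for $i=1$ is $m_1!/m_1!=1$. *)

theory Defs
  imports Complex_Main "HOL-Library.Multiset"
begin

text \<open>
  A tuple \<open>(m\<^sub>1; P\<^sub>2, \<dots>, P\<^sub>k)\<close> is a pair of the number \<open>m\<^sub>1\<close> and the list \<open>[P\<^sub>2, \<dots>, P\<^sub>k]\<close>
  (empty for \<open>k = 1\<close>). An order \<open>(m\<^sub>1, \<dots>, m\<^sub>k)\<close> is given by \<open>k\<close> and a function \<open>m\<close>, of which
  only the values \<open>m 1, \<dots>, m k\<close> matter.
\<close>

type_synonym typed_tuple = "nat \<times> nat list list"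

text \<open>\<open>pref \<alpha> i\<close> is \<open>P\<^sub>i\<close>; it is meaningful for \<open>2 \<le> i \<le> k\<close> only.\<close>

definition pref :: "typed_tuple \<Rightarrow> nat \<Rightarrow> nat list" where
  "pref \<alpha> i = snd \<alpha> ! (i - 2)"

definition has_order :: "nat \<Rightarrow> (nat \<Rightarrow> nat) \<Rightarrow> typed_tuple \<Rightarrow> bool" where
  "has_order k m \<alpha> \<longleftrightarrow>
     fst \<alpha> = m 1 \<and> length (snd \<alpha>) = k - 1 \<and> (\<forall>i\<in>{2..k}. length (pref \<alpha> i) = m i)"

text \<open>The pair \<open>(i, j)\<close> stands for the \<open>j\<close>-th car of type \<open>i\<close>.\<close>

definition cars :: "nat \<Rightarrow> (nat \<Rightarrow> nat) \<Rightarrow> (nat \<times> nat) set" where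
  "cars k m = (SIGMA i:{1..k}. {1..m i})"

definition arrangement :: "nat \<Rightarrow> (nat \<Rightarrow> nat) \<Rightarrow> (nat \<times> nat \<Rightarrow> nat) \<Rightarrow> bool" where
  "arrangement k m s \<longleftrightarrow> bij_betw s (cars k m) {1..(\<Sum>i=1..k. m i)}"

definition lower_before ::
    "nat \<Rightarrow> (nat \<Rightarrow> nat) \<Rightarrow> (nat \<times> nat \<Rightarrow> nat) \<Rightarrow> nat \<Rightarrow> nat \<Rightarrow> nat" where
  "lower_before k m s i j = card {c \<in> cars k m. fst c \<in> {1..i - 1} \<and> s c < s (i, j)}"

definition exact_tpf :: "nat \<Rightarrow> (nat \<Rightarrow> nat) \<Rightarrow> typed_tuple \<Rightarrow> bool" where
  "exact_tpf k m \<alpha> \<longleftrightarrow>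
     has_order k m \<alpha> \<and>
     (\<exists>s. arrangement k m s \<and>
          (\<forall>i\<in>{2..k}. \<forall>j\<in>{1..m i}. lower_before k m s i j = pref \<alpha> i ! (j - 1)))"

definition parking_permutation ::
    "nat \<Rightarrow> (nat \<Rightarrow> nat) \<Rightarrow> typed_tuple \<Rightarrow> typed_tuple \<Rightarrow> bool" where
  "parking_permutation k m \<alpha> \<beta> \<longleftrightarrow>
     exact_tpf k m \<alpha> \<and> exact_tpf k m \<beta> \<and>
     (\<forall>i\<in>{2..k}. mset (pref \<beta> i) = mset (pref \<alpha> i))"

definition fam :: "nat \<Rightarrow> (nat \<Rightarrow> nat) \<Rightarrow> typed_tuple \<Rightarrow> typed_tuple set" where
  "fam k m \<alpha> = {\<beta>. parking_permutation k m \<alpha> \<beta>}"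

definition families :: "nat \<Rightarrow> (nat \<Rightarrow> nat) \<Rightarrow> typed_tuple set set" where
  "families k m = {fam k m \<alpha> | \<alpha>. exact_tpf k m \<alpha>}"

text \<open>For \<open>i = 1\<close> there is no list \<open>P\<^sub>1\<close>, and the denominator is \<open>m\<^sub>1!\<close> by convention.\<close>

definition F :: "nat \<Rightarrow> (nat \<Rightarrow> nat) \<Rightarrow> typed_tuple \<Rightarrow> real" where
  "F k m \<alpha> =
     (\<Prod>i=1..k. fact (m i) /
        (if i = 1 then fact (m 1)
         else (\<Prod>j=0..(\<Sum>l=1..i - 1. m l). fact (count_list (pref \<alpha> i) j))))"

end

theory Submission
  imports Defs "HOL-Combinatorics.Multiset_Permutations" "HOL-Library.FuncSet"
begin

text \<open>
  Write \<open>\<mu>\<^sub>i = m\<^sub>1 + \<dots> + m\<^sub>i\<^sub>-\<^sub>1\<close>. The identity counts all exact \<open>k\<close>-typed parking functions of the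
  given order in two ways.

  On the one hand, a tuple of the right shape is an exact typed parking function if and only if
  every entry of \<open>P\<^sub>i\<close> is at most \<open>\<mu>\<^sub>i\<close> (lemma \<open>exact_tpf_iff_bounded\<close>). The bound is clearly
  necessary, as only \<open>\<mu>\<^sub>i\<close> cars have a smaller type. It is sufficient because the types can be
  parked in increasing order: a car of type \<open>i\<close> with entry \<open>p \<le> \<mu>\<^sub>i\<close> is squeezed into the gap
  after the first \<open>p\<close> of the cars already present, and later insertions do not change how many
  cars of smaller type precede it. Hence the lists \<open>P\<^sub>i\<close> range independently over all lists of
  length \<open>m\<^sub>i\<close> with \<open>1 + \<mu>\<^sub>i\<close> possible values for each entry, which gives the product on the left.

  On the other hand, the families are the classes of the equivalence relation ``equal up to
  rearranging every \<open>P\<^sub>i\<close>'', so they partition the exact typed parking functions. The bounds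
  survive rearrangement, so \<open>fam(\<alpha>)\<close> consists of all ways of rearranging the lists \<open>P\<^sub>i\<close>
  independently, and multinomial coefficients count these: \<open>F(\<alpha>)\<close> is the cardinality of \<open>fam(\<alpha>)\<close>
  (lemma \<open>F_eq_card_fam\<close>).
\<close>

section \<open>Exact typed parking functions are the bounded tuples\<close>

lemma cars_Suc: "cars (Suc k) m = cars k m \<union> Pair (Suc k) ` {1..m (Suc k)}"
  unfolding cars_def by (auto simp: le_Suc_eq)

lemma finite_cars [simp]: "finite (cars k m)"
  unfolding cars_def by auto

lemma card_cars: "card (cars k m) = (\<Sum>i=1..k. m i)"
  unfolding cars_def by simp

lemma lower_before_le: "lower_before k m s i j \<le> (\<Sum>l=1..i - 1. m l)"
proof -
  have "lower_before k m s i j \<le> card (cars (i - 1) m)"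
    unfolding lower_before_def by (rule card_mono) (auto simp: cars_def)
  then show ?thesis by (simp add: card_cars)
qed

text \<open>
  Only the relative order of the cars matters, so it suffices to give the cars pairwise distinct
  positions; replacing each position by its rank turns them into an arrangement.
\<close>

lemma arrangement_of_inj:
  assumes inj: "inj_on s (cars k m)"
  obtains r where "arrangement k m r"
    and "\<And>i j. (i, j) \<in> cars k m \<Longrightarrow> lower_before k m r i j = lower_before k m s i j"
proof
  define r where "r c = card {d \<in> cars k m. s d \<le> s c}" for c
  have less: "r c < r d" if "c \<in> cars k m" "d \<in> cars k m" "s c < s d" for c d
  proof -
    have "d \<in> {e \<in> cars k m. s e \<le> s d} - {e \<in> cars k m. s e \<le> s c}"
      using that by simp
    moreover have "{e \<in> cars k m. s e \<le> s c} \<subseteq> {e \<in> cars k m. s e \<le> s d}"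
      using that by auto
    ultimately show ?thesis
      unfolding r_def by (intro psubset_card_mono) auto
  qed
  have less_iff: "r c < r d \<longleftrightarrow> s c < s d" if "c \<in> cars k m" "d \<in> cars k m" for c d
    using less[OF that] less[OF that(2,1)] inj_onD[OF inj _ that]
    by (metis linorder_less_linear order_less_asym)
  have inj_r: "inj_on r (cars k m)"
    using less_iff inj by (metis inj_on_def linorder_neq_iff)
  have "r ` cars k m \<subseteq> {1..card (cars k m)}"
  proof
    fix x assume "x \<in> r ` cars k m"
    then obtain c where c: "c \<in> cars k m" "x = r c" by auto
    then have "c \<in> {d \<in> cars k m. s d \<le> s c}" by simp
    then have "{d \<in> cars k m. s d \<le> s c} \<noteq> {}" by blast
    then have "0 < r c" unfolding r_def by (simp add: card_gt_0_iff del: Collect_empty_eq)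
    moreover have "r c \<le> card (cars k m)" unfolding r_def by (rule card_mono) auto
    ultimately show "x \<in> {1..card (cars k m)}" using c by auto
  qed
  then have "r ` cars k m = {1..card (cars k m)}"
    by (rule card_subset_eq[rotated]) (simp_all add: card_image[OF inj_r])
  then show "arrangement k m r"
    unfolding arrangement_def bij_betw_def using inj_r by (simp add: card_cars)
  show "lower_before k m r i j = lower_before k m s i j" if "(i, j) \<in> cars k m" for i j
    unfolding lower_before_def
    by (rule arg_cong[where f = card]) (use less_iff[OF _ that] in auto)
qed

text \<open>
  The insertion argument. Type \<open>1\<close> is treated like the other types, with the only possible
  prescription \<open>p 1 j = 0\<close>, so that the induction can start from an empty row.
\<close>

lemma arrangement_exists:
  assumes "\<forall>i\<in>{1..k}. \<forall>j\<in>{1..m i}. p i j \<le> (\<Sum>l=1..i - 1. m l)"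
  shows "\<exists>s. arrangement k m s \<and> (\<forall>i\<in>{1..k}. \<forall>j\<in>{1..m i}. lower_before k m s i j = p i j)"
  using assms
proof (induction k)
  case 0
  then show ?case by (auto simp: arrangement_def cars_def bij_betw_def)
next
  case (Suc k)
  then obtain s where s: "arrangement k m s"
    and before: "\<And>i j. \<lbrakk>i \<in> {1..k}; j \<in> {1..m i}\<rbrakk> \<Longrightarrow> lower_before k m s i j = p i j"
    by fastforce
  define n where "n = m (Suc k)"
  define M where "M = (\<Sum>l=1..k. m l)"
  have s_bij: "bij_betw s (cars k m) {1..M}"
    using s by (simp add: arrangement_def M_def)
  have p_le: "p (Suc k) j \<le> M" if "j \<in> {1..n}" for j
    using Suc.prems[THEN bspec, of "Suc k"] that by (simp add: M_def n_def)
  \<comment> \<open>Stretching the row by the factor \<open>n + 1\<close> leaves \<open>n\<close> free spots directly after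
    spot \<open>p * (n + 1)\<close>; the \<open>j\<close>-th new car takes the \<open>j\<close>-th of them, so that new cars with
    equal entries do not collide.\<close>
  define t where "t = (\<lambda>(i, j). if i \<le> k then s (i, j) * (n + 1) else p i j * (n + 1) + j)"
  have t_old: "t c = s c * (n + 1)" if "c \<in> cars k m" for c
    using that by (auto simp: t_def cars_def)
  have less_old: "t c < t d \<longleftrightarrow> s c < s d" if "c \<in> cars k m" "d \<in> cars k m" for c d
    unfolding that[THEN t_old] mult_less_cancel2 by simp
  have t_new: "t (Suc k, j) = p (Suc k) j * (n + 1) + j" for j
    by (simp add: t_def)
  have mod_old: "t c mod (n + 1) = 0" if "c \<in> cars k m" for c
    by (simp only: t_old[OF that] mod_mult_self2_is_0)
  have mod_new: "t (Suc k, j) mod (n + 1) = j" if "j \<in> {1..n}" for j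
    using that unfolding t_new by (subst mod_mult_self3) auto
  have "inj_on t (cars k m)"
  proof (rule inj_onI)
    fix c d assume "c \<in> cars k m" "d \<in> cars k m" "t c = t d"
    then show "c = d"
      using t_old[of c] t_old[of d] bij_betw_imp_inj_on[OF s_bij]
      by (metis add_is_0 inj_onD mult_cancel2 one_neq_zero)
  qed
  moreover have "inj_on t (Pair (Suc k) ` {1..n})"
    by (rule inj_onI) (metis imageE mod_new)
  moreover have "t ` cars k m \<inter> t ` Pair (Suc k) ` {1..n} = {}"
    using mod_old mod_new by fastforce
  ultimately have "inj_on t (cars (Suc k) m)"
    unfolding cars_Suc n_def[symmetric] by (subst inj_on_Un) blast
  then obtain r where r: "arrangement (Suc k) m r"
    and r_before: "\<And>i j. (i, j) \<in> cars (Suc k) m \<Longrightarrow>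
      lower_before (Suc k) m r i j = lower_before (Suc k) m t i j"
    by (rule arrangement_of_inj) blast
  have "lower_before (Suc k) m r i j = p i j" if ij: "i \<in> {1..Suc k}" "j \<in> {1..m i}" for i j
  proof -
    have "lower_before (Suc k) m r i j = lower_before (Suc k) m t i j"
      using ij by (intro r_before) (auto simp: cars_def)
    also have "\<dots> = p i j"
    proof (cases "i = Suc k")
      case False
      then have i: "i \<in> {1..k}" using ij by auto
      then have mem: "(i, j) \<in> cars k m" using ij by (auto simp: cars_def)
      have "{c \<in> cars (Suc k) m. fst c \<in> {1..i - 1} \<and> t c < t (i, j)} =
            {c \<in> cars k m. fst c \<in> {1..i - 1} \<and> s c < s (i, j)}"
        using i less_old mem by (auto simp: cars_Suc)
      then show ?thesis using before[OF i ij(2)] by (simp add: lower_before_def)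
    next
      case True
      then have j: "j \<in> {1..n}" using ij by (simp add: n_def)
      let ?p = "p (Suc k) j"
      have iff: "t c < t (Suc k, j) \<longleftrightarrow> s c \<le> ?p" if "c \<in> cars k m" for c
      proof
        assume "s c \<le> ?p"
        then have "s c * (n + 1) \<le> ?p * (n + 1)" by (rule mult_le_mono1)
        then show "t c < t (Suc k, j)" using j by (simp add: t_old[OF that] t_new)
      next
        assume "t c < t (Suc k, j)"
        then have "s c * (n + 1) < (?p + 1) * (n + 1)"
          using j by (simp add: t_old[OF that] t_new)
        then show "s c \<le> ?p" by (simp only: mult_less_cancel2) simp
      qed
      have "{c \<in> cars (Suc k) m. fst c \<in> {1..Suc k - 1} \<and> t c < t (Suc k, j)} =
            {c \<in> cars k m. s c \<in> {1..?p}}"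
        using iff bij_betwE[OF s_bij] by (fastforce simp: cars_Suc cars_def)
      also have "card \<dots> = card {1..?p}"
      proof -
        have "s ` {c \<in> cars k m. s c \<in> {1..?p}} = {1..?p}"
          using bij_betw_imp_surj_on[OF s_bij] p_le[OF j] by fastforce
        moreover have "inj_on s {c \<in> cars k m. s c \<in> {1..?p}}"
          using bij_betw_imp_inj_on[OF s_bij] by (rule inj_on_subset) auto
        ultimately show ?thesis by (metis card_image)
      qed
      finally show ?thesis using True by (simp add: lower_before_def)
    qed
    finally show ?thesis .
  qed
  then show ?case using r by blast
qed

lemma exact_tpf_iff_bounded:
  "exact_tpf k m \<alpha> \<longleftrightarrow>
     has_order k m \<alpha> \<and> (\<forall>i\<in>{2..k}. set (pref \<alpha> i) \<subseteq> {0..(\<Sum>l=1..i - 1. m l)})"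
proof (intro iffI conjI ballI subsetI)
  assume tpf: "exact_tpf k m \<alpha>"
  then show "has_order k m \<alpha>" by (simp add: exact_tpf_def)
  fix i x assume i: "i \<in> {2..k}" and "x \<in> set (pref \<alpha> i)"
  then obtain q where "q < m i" "x = pref \<alpha> i ! q"
    using tpf by (auto simp: exact_tpf_def has_order_def in_set_conv_nth)
  moreover from this have "Suc q \<in> {1..m i}" by simp
  ultimately show "x \<in> {0..(\<Sum>l=1..i - 1. m l)}"
    using tpf i lower_before_le unfolding exact_tpf_def
    by (metis atLeastAtMost_iff diff_Suc_1 zero_le)
next
  assume *: "has_order k m \<alpha> \<and> (\<forall>i\<in>{2..k}. set (pref \<alpha> i) \<subseteq> {0..(\<Sum>l=1..i - 1. m l)})"
  define p where "p i j = (if i = 1 then 0 else pref \<alpha> i ! (j - 1))" for i j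
  have "p i j \<le> (\<Sum>l=1..i - 1. m l)" if "i \<in> {1..k}" "j \<in> {1..m i}" for i j
  proof (cases "i = 1")
    case False
    then have i: "i \<in> {2..k}" using that by auto
    then have "pref \<alpha> i ! (j - 1) \<in> set (pref \<alpha> i)"
      using * that by (intro nth_mem) (auto simp: has_order_def)
    moreover have "set (pref \<alpha> i) \<subseteq> {0..(\<Sum>l=1..i - 1. m l)}"
      using * i by blast
    ultimately have "pref \<alpha> i ! (j - 1) \<in> {0..(\<Sum>l=1..i - 1. m l)}" by blast
    then show ?thesis using False by (simp only: p_def if_False atLeastAtMost_iff)
  qed (simp add: p_def)
  then obtain s where "arrangement k m s"
    and s: "\<forall>i\<in>{1..k}. \<forall>j\<in>{1..m i}. lower_before k m s i j = p i j"
    using arrangement_exists by blast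
  moreover have "\<forall>i\<in>{2..k}. \<forall>j\<in>{1..m i}. lower_before k m s i j = pref \<alpha> i ! (j - 1)"
    using s by (auto simp: p_def)
  ultimately show "exact_tpf k m \<alpha>"
    using * unfolding exact_tpf_def by blast
qed

section \<open>Counting tuples and families\<close>

lemma tuples_bij_betw_PiE:
  "bij_betw (\<lambda>\<beta>. restrict (pref \<beta>) {2..k})
     {\<beta>. fst \<beta> = a \<and> length (snd \<beta>) = k - 1 \<and> (\<forall>i\<in>{2..k}. pref \<beta> i \<in> S i)}
     (PiE {2..k} S)"
proof (rule bij_betw_byWitness[where f' = "\<lambda>f. (a, map f [2..<Suc k])"])
  have pref: "pref (a, map f [2..<Suc k]) i = f i" if "i \<in> {2..k}" for f i
  proof -
    have "i - 2 < Suc k - 2" "2 + (i - 2) = i" using that by auto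
    then show ?thesis by (simp only: pref_def snd_conv nth_map_upt)
  qed
  show "\<forall>\<beta>\<in>{\<beta>. fst \<beta> = a \<and> length (snd \<beta>) = k - 1 \<and> (\<forall>i\<in>{2..k}. pref \<beta> i \<in> S i)}.
      (a, map (restrict (pref \<beta>) {2..k}) [2..<Suc k]) = \<beta>"
    by (auto intro!: nth_equalityI simp: pref_def simp del: upt_Suc)
  show "\<forall>f\<in>PiE {2..k} S. restrict (pref (a, map f [2..<Suc k])) {2..k} = f"
    using pref by (auto simp: restrict_def PiE_def extensional_def fun_eq_iff)
  show "(\<lambda>\<beta>. restrict (pref \<beta>) {2..k}) `
      {\<beta>. fst \<beta> = a \<and> length (snd \<beta>) = k - 1 \<and> (\<forall>i\<in>{2..k}. pref \<beta> i \<in> S i)}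
      \<subseteq> PiE {2..k} S"
    by auto
  show "(\<lambda>f. (a, map f [2..<Suc k])) ` PiE {2..k} S \<subseteq>
      {\<beta>. fst \<beta> = a \<and> length (snd \<beta>) = k - 1 \<and> (\<forall>i\<in>{2..k}. pref \<beta> i \<in> S i)}"
    using pref by (auto simp del: upt_Suc)
qed

text \<open>
  Both counts are instances of this one: all exact typed parking functions, and those in a
  given family, are obtained by choosing the lists \<open>P\<^sub>2, \<dots>, P\<^sub>k\<close> independently of each other.
\<close>

lemma card_tuples:
  "card {\<beta>. fst \<beta> = a \<and> length (snd \<beta>) = k - 1 \<and> (\<forall>i\<in>{2..k}. pref \<beta> i \<in> S i)} =
     (\<Prod>i=2..k. card (S i))"
  using bij_betw_same_card[OF tuples_bij_betw_PiE] by (simp add: card_PiE)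

lemma Collect_exact_tpf:
  "Collect (exact_tpf k m) =
     {\<beta>. fst \<beta> = m 1 \<and> length (snd \<beta>) = k - 1 \<and>
         (\<forall>i\<in>{2..k}. pref \<beta> i \<in> {xs. set xs \<subseteq> {0..(\<Sum>l=1..i - 1. m l)} \<and> length xs = m i})}"
  unfolding exact_tpf_iff_bounded has_order_def by blast

lemma card_exact_tpf:
  "card (Collect (exact_tpf k m)) = (\<Prod>i=2..k. (1 + (\<Sum>l=1..i - 1. m l)) ^ m i)"
  unfolding Collect_exact_tpf card_tuples by (simp add: card_lists_length_eq)

lemma finite_exact_tpf: "finite (Collect (exact_tpf k m))"
  unfolding Collect_exact_tpf bij_betw_finite[OF tuples_bij_betw_PiE]
  by (intro finite_PiE finite_lists_length_eq) auto

lemma fam_eq: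
  assumes \<alpha>: "exact_tpf k m \<alpha>"
  shows "fam k m \<alpha> =
     {\<beta>. fst \<beta> = m 1 \<and> length (snd \<beta>) = k - 1 \<and>
         (\<forall>i\<in>{2..k}. pref \<beta> i \<in> permutations_of_multiset (mset (pref \<alpha> i)))}"
proof -
  have tpf: "exact_tpf k m \<beta>"
    if "fst \<beta> = m 1" "length (snd \<beta>) = k - 1"
      and perm: "\<forall>i\<in>{2..k}. mset (pref \<beta> i) = mset (pref \<alpha> i)" for \<beta>
  proof -
    have "length (pref \<beta> i) = m i \<and> set (pref \<beta> i) \<subseteq> {0..(\<Sum>l=1..i - 1. m l)}"
      if i: "i \<in> {2..k}" for i
    proof -
      have "mset (pref \<beta> i) = mset (pref \<alpha> i)"
        using perm i by (rule bspec)
      then have "length (pref \<beta> i) = length (pref \<alpha> i)" "set (pref \<beta> i) = set (pref \<alpha> i)"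
        by (rule mset_eq_length, rule mset_eq_setD)
      then show ?thesis
        using \<alpha> i unfolding exact_tpf_iff_bounded has_order_def by metis
    qed
    then show ?thesis
      using that unfolding exact_tpf_iff_bounded has_order_def by blast
  qed
  have "fst \<beta> = m 1" "length (snd \<beta>) = k - 1" if "exact_tpf k m \<beta>" for \<beta>
    using that by (simp_all add: exact_tpf_def has_order_def)
  with tpf \<alpha> show ?thesis
    unfolding fam_def parking_permutation_def permutations_of_multiset_def by blast
qed

text \<open>
  The product may run over any finite range containing the entries of the list, because values
  that do not occur contribute the factor \<open>0! = 1\<close>.
\<close>

lemma card_permutations_of_list:
  assumes "finite A" "set xs \<subseteq> A"
  shows "real (card (permutations_of_multiset (mset xs))) =
    fact (length xs) / (\<Prod>x\<in>A. fact (count_list xs x))"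
proof -
  have "(\<Prod>x\<in>A. fact (count_list xs x) :: real) = (\<Prod>x\<in>set xs. fact (count_list xs x))"
    using assms by (intro prod.mono_neutral_right) (auto simp: count_list_0_iff)
  moreover have "real (card (permutations_of_multiset (mset xs))) *
      (\<Prod>x\<in>set xs. fact (count_list xs x)) = fact (length xs)"
    using arg_cong[OF card_permutations_of_multiset_aux[of "mset xs"], of real]
    by (simp add: count_mset)
  ultimately show ?thesis
    by (simp add: eq_divide_eq)
qed

lemma F_eq_card_fam:
  assumes k: "k \<ge> 1" and \<alpha>: "exact_tpf k m \<alpha>"
  shows "F k m \<alpha> = real (card (fam k m \<alpha>))"
proof -
  have "F k m \<alpha> = (\<Prod>i=2..k. fact (m i) /
      (\<Prod>j=0..(\<Sum>l=1..i - 1. m l). fact (count_list (pref \<alpha> i) j)))"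
    unfolding F_def using k by (simp add: prod.atLeast_Suc_atMost numeral_2_eq_2)
  also have "\<dots> = (\<Prod>i=2..k. real (card (permutations_of_multiset (mset (pref \<alpha> i)))))"
  proof (rule prod.cong)
    fix i assume "i \<in> {2..k}"
    then have "length (pref \<alpha> i) = m i" "set (pref \<alpha> i) \<subseteq> {0..(\<Sum>l=1..i - 1. m l)}"
      using \<alpha> by (auto simp: exact_tpf_iff_bounded has_order_def)
    then show "fact (m i) / (\<Prod>j=0..(\<Sum>l=1..i - 1. m l). fact (count_list (pref \<alpha> i) j)) =
        real (card (permutations_of_multiset (mset (pref \<alpha> i))))"
      using card_permutations_of_list[of "{0..(\<Sum>l=1..i - 1. m l)}" "pref \<alpha> i"] by simp
  qed simp
  also have "\<dots> = real (card (fam k m \<alpha>))"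
    unfolding fam_eq[OF \<alpha>] card_tuples by simp
  finally show ?thesis .
qed

lemma Union_families: "\<Union> (families k m) = Collect (exact_tpf k m)"
  unfolding families_def fam_def parking_permutation_def by auto

lemma pairwise_disjnt_families: "pairwise disjnt (families k m)"
proof (rule pairwiseI, rule ccontr)
  fix A B assume "A \<in> families k m" "B \<in> families k m" "A \<noteq> B" "\<not> disjnt A B"
  then obtain \<alpha> \<beta> \<gamma> where "A = fam k m \<alpha>" "B = fam k m \<beta>" "\<gamma> \<in> fam k m \<alpha>" "\<gamma> \<in> fam k m \<beta>"
    unfolding families_def disjnt_iff by blast
  then have "A = B"
    by (simp add: fam_def parking_permutation_def)
  with \<open>A \<noteq> B\<close> show False ..
qed

theorem mainTheorem7:
  fixes k L :: nat and m :: "nat \<Rightarrow> nat" and \<alpha> :: "nat \<Rightarrow> typed_tuple"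
  assumes "k \<ge> 1"
    and "\<forall>i\<in>{1..k}. m i > 0"
    and "L = (\<Prod>i=1..k. (\<Sum>j=1..i. m j) choose m i)"
    and "\<forall>j\<in>{1..L}. exact_tpf k m (\<alpha> j)"
    and "bij_betw (\<lambda>j. fam k m (\<alpha> j)) {1..L} (families k m)"
  shows "real (\<Prod>i=2..k. (1 + (\<Sum>j=1..i - 1. m j)) ^ m i) = (\<Sum>j=1..L. F k m (\<alpha> j))"
proof -
  have "real (\<Prod>i=2..k. (1 + (\<Sum>j=1..i - 1. m j)) ^ m i) = real (card (\<Union> (families k m)))"
    by (simp only: Union_families card_exact_tpf)
  also have "\<dots> = (\<Sum>A\<in>families k m. real (card A))"
  proof -
    have "finite A" if "A \<in> families k m" for A
      using that Union_families finite_exact_tpf by (metis Union_upper finite_subset)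
    then show ?thesis
      by (subst card_Union_disjoint[OF pairwise_disjnt_families]) auto
  qed
  also have "\<dots> = (\<Sum>j=1..L. real (card (fam k m (\<alpha> j))))"
    by (rule sum.reindex_bij_betw[OF assms(5), symmetric])
  also have "\<dots> = (\<Sum>j=1..L. F k m (\<alpha> j))"
    using assms(1,4) by (intro sum.cong) (auto simp: F_eq_card_fam)
  finally show ?thesis .
qed

end
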